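(* Let $\eta>0$, $n\ge 1$, $b\in\{1,\dots,n\}$, and let $x_i=(a_i,y_i)$, $i=1,\dots,n$, with $a_i\in\mathbb{R}^d$, $y_i\in\mathbb{R}$. Let $(\Omega_k)_{k\ge1}$ be i.i.d. uniformly random subsets of $\{1,\dots,n\}$ of cardinality $b$, and set $H_k:=\sum_{i\in\Omega_k}a_ia_i^{\top}$, $q_k:=\sum_{i\in\Omega_k}a_iy_i$. Consider the Markov chain $\theta_k=\left(I-\frac{\eta}{b}H_k\right)\theta_{k-1}+\frac{\eta}{b}q_k$ on $\mathbb{R}^d$ with transition kernel $P$. Assume $\rho:=\mathbb{E}\left\Vert I-\frac{\eta}{b}H_1\right\Vert<1$. Then for every $k\in\mathbb{N}$ and all $\theta,\tilde\theta\in\mathbb{R}^d$, $$\mathcal{W}_1\big(P^k(\theta,\cdot),P^k(\tilde\theta,\cdot)\big)\le\rho^k\Vert\theta-\tilde\theta\Vert.$$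
   Context: This is SGD with batch size $b$ and step size $\eta$ for the quadratic loss $f(\theta,x_i)=(a_i^\top\theta-y_i)^2/2$. $\Vert\cdot\Vert$ on matrices is the operator norm. $P^k(\theta,\cdot)$ is the law of $\theta_k$ when $\theta_0=\theta$. $\mathcal{W}_1$ is the 1-Wasserstein distance: $\mathcal{W}_1(\mu,\nu)=\inf\mathbb{E}\Vert X-Y\Vert$ over couplings of $X\sim\mu$, $Y\sim\nu$. *)

theory Defs
  imports "HOL-Analysis.Analysis" "HOL-Probability.Probability"
begin

text \<open>Mini-batch SGD for the quadratic loss. Data points x_i = (a i, y i), i = 1..n.\<close>

definition batches :: "nat \<Rightarrow> nat \<Rightarrow> nat set set" where
  "batches n b = {S. S \<subseteq> {1..n} \<and> card S = b}"

text \<open>Law of a uniformly random batch Omega_k.\<close>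
definition batch_pmf :: "nat \<Rightarrow> nat \<Rightarrow> nat set pmf" where
  "batch_pmf n b = pmf_of_set (batches n b)"

text \<open>H = sum_{i in S} a_i a_i^T\<close>
definition sgd_H :: "(nat \<Rightarrow> real^'d) \<Rightarrow> nat set \<Rightarrow> real^'d^'d" where
  "sgd_H a S = (\<Sum>i\<in>S. (\<chi> j k. a i $ j * a i $ k))"

text \<open>q = sum_{i in S} a_i y_i\<close>
definition sgd_q :: "(nat \<Rightarrow> real^'d) \<Rightarrow> (nat \<Rightarrow> real) \<Rightarrow> nat set \<Rightarrow> real^'d" where
  "sgd_q a y S = (\<Sum>i\<in>S. y i *\<^sub>R a i)"

text \<open>The iteration matrix I - (eta/b) H.\<close>
definition sgd_M :: "real \<Rightarrow> nat \<Rightarrow> (nat \<Rightarrow> real^'d) \<Rightarrow> nat set \<Rightarrow> real^'d^'d" where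
  "sgd_M \<eta> b a S = mat 1 - (\<eta> / real b) *\<^sub>R sgd_H a S"

definition sgd_step :: "real \<Rightarrow> nat \<Rightarrow> (nat \<Rightarrow> real^'d) \<Rightarrow> (nat \<Rightarrow> real) \<Rightarrow> nat set \<Rightarrow> real^'d \<Rightarrow> real^'d" where
  "sgd_step \<eta> b a y S \<theta> = sgd_M \<eta> b a S *v \<theta> + (\<eta> / real b) *\<^sub>R sgd_q a y S"

text \<open>Transition kernel P(theta, .) of the Markov chain.\<close>
definition sgd_kernel :: "real \<Rightarrow> nat \<Rightarrow> nat \<Rightarrow> (nat \<Rightarrow> real^'d) \<Rightarrow> (nat \<Rightarrow> real) \<Rightarrow> real^'d \<Rightarrow> (real^'d) pmf" where
  "sgd_kernel \<eta> n b a y \<theta> = map_pmf (\<lambda>S. sgd_step \<eta> b a y S \<theta>) (batch_pmf n b)"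

text \<open>k-step kernel P^k(theta, .) = law of theta_k given theta_0 = theta.\<close>
fun sgd_kernel_pow :: "real \<Rightarrow> nat \<Rightarrow> nat \<Rightarrow> (nat \<Rightarrow> real^'d) \<Rightarrow> (nat \<Rightarrow> real) \<Rightarrow> nat \<Rightarrow> real^'d \<Rightarrow> (real^'d) pmf" where
  "sgd_kernel_pow \<eta> n b a y 0 \<theta> = return_pmf \<theta>"
| "sgd_kernel_pow \<eta> n b a y (Suc k) \<theta> = bind_pmf (sgd_kernel_pow \<eta> n b a y k \<theta>) (sgd_kernel \<eta> n b a y)"

text \<open>1-Wasserstein distance between discrete laws: infimum over couplings of E||X - Y||
  (extended-real valued, so no integrability side conditions).\<close>
definition wasserstein1 :: "('a::real_normed_vector) pmf \<Rightarrow> 'a pmf \<Rightarrow> ennreal" where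
  "wasserstein1 \<mu> \<nu> = (INF \<gamma> \<in> {\<gamma>. map_pmf fst \<gamma> = \<mu> \<and> map_pmf snd \<gamma> = \<nu>}.
      \<integral>\<^sup>+ z. ennreal (norm (fst z - snd z)) \<partial>measure_pmf \<gamma>)"

text \<open>rho = E || I - (eta/b) H_1 ||, operator norm.\<close>
definition sgd_rho :: "real \<Rightarrow> nat \<Rightarrow> nat \<Rightarrow> (nat \<Rightarrow> real^'d) \<Rightarrow> real" where
  "sgd_rho \<eta> n b a = measure_pmf.expectation (batch_pmf n b) (\<lambda>S. onorm (\<lambda>v. sgd_M \<eta> b a S *v v))"

end

theory Submission
  imports Defs
begin

text \<open>Run two copies of the chain synchronously, driven by the same batch at every step.
  Each step is the affine map \<open>\<theta> \<mapsto> M\<^sub>S \<theta> + c\<^sub>S\<close>, which is \<open>\<parallel>M\<^sub>S\<parallel>\<close>-Lipschitz, and the batch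
  of step \<open>k + 1\<close> is independent of the pair reached after \<open>k\<close> steps; hence the expected
  distance of the two copies shrinks by the factor \<open>\<rho> = E \<parallel>M\<^sub>S\<parallel>\<close> per step. The law of the
  pair is a coupling of the two \<open>k\<close>-step laws, which bounds their Wasserstein distance.\<close>

lemma wasserstein1_le_coupling:
  assumes "map_pmf fst \<gamma> = \<mu>" and "map_pmf snd \<gamma> = \<nu>"
  shows "wasserstein1 \<mu> \<nu> \<le> (\<integral>\<^sup>+ z. ennreal (norm (fst z - snd z)) \<partial>measure_pmf \<gamma>)"
  unfolding wasserstein1_def using assms by (intro INF_lower) simp

fun sync_coupling :: "'i pmf \<Rightarrow> ('i \<Rightarrow> 'a \<Rightarrow> 'a) \<Rightarrow> nat \<Rightarrow> 'a \<Rightarrow> 'a \<Rightarrow> ('a \<times> 'a) pmf" where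
  "sync_coupling p f 0 u v = return_pmf (u, v)"
| "sync_coupling p f (Suc k) u v =
     bind_pmf (sync_coupling p f k u v) (\<lambda>z. map_pmf (\<lambda>S. (f S (fst z), f S (snd z))) p)"

lemma nn_integral_dist_sync_coupling_le:
  assumes lipschitz: "\<And>S. (L S)-lipschitz_on UNIV (f S)"
  shows "(\<integral>\<^sup>+ z. ennreal (dist (fst z) (snd z)) \<partial>measure_pmf (sync_coupling p f k u v))
           \<le> (\<integral>\<^sup>+ S. ennreal (L S) \<partial>measure_pmf p) ^ k * ennreal (dist u v)"
proof (induction k)
  case 0
  then show ?case by simp
next
  case (Suc k)
  let ?EL = "\<integral>\<^sup>+ S. ennreal (L S) \<partial>measure_pmf p"
  have step: "ennreal (dist (f S x) (f S x')) \<le> ennreal (L S) * ennreal (dist x x')" for S x x'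
    using lipschitz_onD[OF lipschitz] lipschitz_on_nonneg[OF lipschitz]
    by (simp add: ennreal_mult[symmetric])
  have "(\<integral>\<^sup>+ z. ennreal (dist (fst z) (snd z)) \<partial>measure_pmf (sync_coupling p f (Suc k) u v))
      = (\<integral>\<^sup>+ z. \<integral>\<^sup>+ S. ennreal (dist (f S (fst z)) (f S (snd z)))
            \<partial>measure_pmf p \<partial>measure_pmf (sync_coupling p f k u v))"
    by simp
  also have "\<dots> \<le> (\<integral>\<^sup>+ z. \<integral>\<^sup>+ S. ennreal (L S) * ennreal (dist (fst z) (snd z))
            \<partial>measure_pmf p \<partial>measure_pmf (sync_coupling p f k u v))"
    by (intro nn_integral_mono step)
  also have "\<dots> = ?EL * (\<integral>\<^sup>+ z. ennreal (dist (fst z) (snd z))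
            \<partial>measure_pmf (sync_coupling p f k u v))"
    by (simp add: nn_integral_multc nn_integral_cmult)
  also have "\<dots> \<le> ?EL * (?EL ^ k * ennreal (dist u v))"
    by (intro mult_left_mono Suc.IH) simp
  finally show ?case
    by (simp add: mult.assoc)
qed

lemma lipschitz_on_matrix_affine:
  fixes M :: "real^'n^'m"
  shows "(onorm ((*v) M))-lipschitz_on X (\<lambda>x. M *v x + c)"
proof (rule lipschitz_onI)
  show "0 \<le> onorm ((*v) M)"
    by (rule onorm_pos_le[OF matrix_vector_mul_bounded_linear])
  show "dist (M *v x + c) (M *v x' + c) \<le> onorm ((*v) M) * dist x x'" for x x'
    using onorm[OF matrix_vector_mul_bounded_linear, of M "x - x'"]
    by (simp add: dist_norm matrix_vector_mult_diff_distrib)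
qed

lemma lipschitz_on_sgd_step:
  "(onorm ((*v) (sgd_M \<eta> b a S)))-lipschitz_on UNIV (sgd_step \<eta> b a y S)"
  unfolding sgd_step_def[abs_def] by (rule lipschitz_on_matrix_affine)

lemma map_fst_sync_coupling_sgd:
  "map_pmf fst (sync_coupling (batch_pmf n b) (sgd_step \<eta> b a y) k u v) = sgd_kernel_pow \<eta> n b a y k u"
proof (induction k)
  case (Suc k)
  show ?case
    by (simp add: Suc.IH[symmetric] map_bind_pmf bind_map_pmf map_pmf_comp sgd_kernel_def o_def)
qed simp

lemma map_snd_sync_coupling_sgd:
  "map_pmf snd (sync_coupling (batch_pmf n b) (sgd_step \<eta> b a y) k u v) = sgd_kernel_pow \<eta> n b a y k v"
proof (induction k)
  case (Suc k)
  show ?case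
    by (simp add: Suc.IH[symmetric] map_bind_pmf bind_map_pmf map_pmf_comp sgd_kernel_def o_def)
qed simp

lemma finite_batches: "finite (batches n b)"
  unfolding batches_def by (rule finite_subset[of _ "Pow {1..n}"]) auto

lemma set_pmf_batch_pmf:
  assumes "b \<le> n"
  shows "set_pmf (batch_pmf n b) = batches n b"
proof -
  have "{1..b} \<in> batches n b"
    using assms unfolding batches_def by auto
  then show ?thesis
    unfolding batch_pmf_def using finite_batches by (intro set_pmf_of_set) auto
qed

lemma nn_integral_onorm_sgd_M:
  assumes "b \<le> n"
  shows "(\<integral>\<^sup>+ S. ennreal (onorm ((*v) (sgd_M \<eta> b a S))) \<partial>measure_pmf (batch_pmf n b))
           = ennreal (sgd_rho \<eta> n b a)"
  unfolding sgd_rho_def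
  using set_pmf_batch_pmf[OF assms] finite_batches
  by (intro nn_integral_eq_integral)
    (auto simp: integrable_measure_pmf_finite onorm_pos_le[OF matrix_vector_mul_bounded_linear])

lemma sgd_rho_nonneg: "0 \<le> sgd_rho \<eta> n b a"
  unfolding sgd_rho_def
  by (intro integral_nonneg_AE) (simp add: onorm_pos_le[OF matrix_vector_mul_bounded_linear])

theorem lemma3p1:
  fixes \<eta> :: real and n b :: nat and a :: "nat \<Rightarrow> real^'d" and y :: "nat \<Rightarrow> real"
    and k :: nat and \<theta> \<theta>' :: "real^'d"
  assumes "\<eta> > 0" and "n \<ge> 1" and "1 \<le> b" and "b \<le> n"
    and "sgd_rho \<eta> n b a < 1"
  shows "wasserstein1 (sgd_kernel_pow \<eta> n b a y k \<theta>) (sgd_kernel_pow \<eta> n b a y k \<theta>')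
           \<le> ennreal (sgd_rho \<eta> n b a ^ k * norm (\<theta> - \<theta>'))"
proof -
  let ?\<gamma> = "sync_coupling (batch_pmf n b) (sgd_step \<eta> b a y) k \<theta> \<theta>'"
  have "wasserstein1 (sgd_kernel_pow \<eta> n b a y k \<theta>) (sgd_kernel_pow \<eta> n b a y k \<theta>')
      \<le> (\<integral>\<^sup>+ z. ennreal (dist (fst z) (snd z)) \<partial>measure_pmf ?\<gamma>)"
    using wasserstein1_le_coupling[OF map_fst_sync_coupling_sgd map_snd_sync_coupling_sgd]
    by (simp add: dist_norm)
  also have "\<dots> \<le> ennreal (sgd_rho \<eta> n b a) ^ k * ennreal (dist \<theta> \<theta>')"
    unfolding nn_integral_onorm_sgd_M[OF \<open>b \<le> n\<close>, symmetric]
    by (rule nn_integral_dist_sync_coupling_le[OF lipschitz_on_sgd_step])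
  also have "\<dots> = ennreal (sgd_rho \<eta> n b a ^ k * norm (\<theta> - \<theta>'))"
    by (simp add: ennreal_power ennreal_mult sgd_rho_nonneg dist_norm)
  finally show ?thesis .
qed

end
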